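(* Let $m\in\{1,2\}$ and let $r_1,r_2$ satisfy $\beta_m<r_1<r_2<\alpha_{m+1}$. For $k=1,2$ let $x_k$ be the Nash equilibrium threshold value in the non-reneging case when the reward is $R_0=r_k$ (the parameters $\lambda,\mu,q$ being the same), and let $z^{(x_k)}_{m,m}=r_k-w^{(x_k)}_{m,m}$ be the corresponding expected payoff of a customer joining at position $m$. Then $$z^{(x_1)}_{m,m}>z^{(x_2)}_{m,m}.$$
   Context: Model (no reneging). Parameters $\lambda,\mu>0$, $0<q<1$, and reward $R_0>0$. Single-server first-come-first-served queue: Poisson arrivals of rate $\lambda$, i.i.d. exponential($\mu$) services. After each service a customer departs successfully with probability $q$, and otherwise immediately rejoins the end of the queue. An arriving customer who sees $j-1$ customers in the system may join, taking position $j$ (position 1 is in service), or balk; once joined she stays until success. Waiting costs 1 per unit time, and success gives reward $R_0$. Threshold strategy: for $x\ge 0$, with $n=\lfloor x\rfloor$ and $p=x-n$, a customer using threshold $x$ joins at position $i$ with probability $u^{(x)}(i)$, where $u^{(x)}(i)=1$ if $i\le n$, $u^{(x)}(n+1)=p$, and $u^{(x)}(i)=0$ if $i\ge n+2$. For $1\le i\le j\le\lceil x\rceil+1$, $w^{(x)}_{i,j}$ is the expected remaining time until a tagged customer departs when she is in position $i$, there are $j$ customers in the system and all other customers use threshold $x$. Equivalently, $(w^{(x)}_{i,j})$ is the unique solution of $$(\lambda+\mu)w_{i,j}=1+\lambda\left[u^{(x)}(j+1)w_{i,j+1}+(1-u^{(x)}(j+1))w_{i,j}\right]+\mu\, s_{i,j},$$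 where $s_{1,j}=(1-q)w_{j,j}$ and $s_{i,j}=q\,w_{i-1,j-1}+(1-q)\,w_{i-1,j}$ for $i>1$ (terms with zero coefficient are omitted). For $m\ge1$: $\alpha_m=w^{(m)}_{m,m}$, $\beta_m=w^{(m)}_{m+1,m+1}$ (these do not depend on the reward). When $\beta_m<R_0<\alpha_{m+1}$, the Nash equilibrium threshold is the unique $x\in(m,m+1)$ with $w^{(x)}_{m+1,m+1}=R_0$. *)

theory Defs
  imports "HOL-Analysis.Analysis"
begin

(* The arrival rate, service rate and success probability are the arguments lam, mu and q. *)

definition join_prob :: "real \<Rightarrow> nat \<Rightarrow> real" where
  "join_prob x i =
     (let n = nat \<lfloor>x\<rfloor>; p = x - real n
      in if i \<le> n then 1 else if i = n + 1 then p else 0)"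

definition queue_states :: "real \<Rightarrow> (nat \<times> nat) set" where
  "queue_states x = {(i, j). 1 \<le> i \<and> i \<le> j \<and> j \<le> nat \<lceil>x\<rceil> + 1}"

definition after_service :: "real \<Rightarrow> (nat \<Rightarrow> nat \<Rightarrow> real) \<Rightarrow> nat \<Rightarrow> nat \<Rightarrow> real" where
  "after_service q w i j =
     (if i = 1 then (1 - q) * w j j
      else q * w (i - 1) (j - 1) + (1 - q) * w (i - 1) j)"

(* For j = nat \<lceil>x\<rceil> + 1 the pair (i, j + 1) lies outside queue_states x, but its coefficient
   join_prob x (j + 1) is 0 there. *)
definition waiting_equations ::
  "real \<Rightarrow> real \<Rightarrow> real \<Rightarrow> real \<Rightarrow> (nat \<Rightarrow> nat \<Rightarrow> real) \<Rightarrow> bool" where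
  "waiting_equations lam mu q x w \<longleftrightarrow>
     (\<forall>(i, j) \<in> queue_states x.
        (lam + mu) * w i j =
          1 + lam * (join_prob x (j + 1) * w i (j + 1) + (1 - join_prob x (j + 1)) * w i j)
            + mu * after_service q w i j)"

(* Expected remaining time of a tagged customer in position i out of j when all others use
   threshold x. The entries outside queue_states x are set to 0 only so that the solution is
   unique as a total function. *)
definition wait :: "real \<Rightarrow> real \<Rightarrow> real \<Rightarrow> real \<Rightarrow> nat \<Rightarrow> nat \<Rightarrow> real" where
  "wait lam mu q x =
     (THE w. waiting_equations lam mu q x w \<and>
             (\<forall>i j. (i, j) \<notin> queue_states x \<longrightarrow> w i j = 0))"

definition alpha :: "real \<Rightarrow> real \<Rightarrow> real \<Rightarrow> nat \<Rightarrow> real" where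
  "alpha lam mu q m = wait lam mu q (real m) m m"

definition beta :: "real \<Rightarrow> real \<Rightarrow> real \<Rightarrow> nat \<Rightarrow> real" where
  "beta lam mu q m = wait lam mu q (real m) (m + 1) (m + 1)"

(* The Nash equilibrium threshold for a reward R with
   beta lam mu q m < R < alpha lam mu q (m + 1); not meaningful for other rewards. *)
definition nash_threshold :: "real \<Rightarrow> real \<Rightarrow> real \<Rightarrow> nat \<Rightarrow> real \<Rightarrow> real" where
  "nash_threshold lam mu q m R =
     (THE x. x \<in> {real m<..<real (m + 1)} \<and> wait lam mu q x (m + 1) (m + 1) = R)"

definition payoff :: "real \<Rightarrow> real \<Rightarrow> real \<Rightarrow> real \<Rightarrow> real \<Rightarrow> nat \<Rightarrow> nat \<Rightarrow> real" where
  "payoff lam mu q R x i j = R - wait lam mu q x i j"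

end

theory Submission
  imports Defs
begin

text \<open>
  Write the threshold as \<open>x = m + p\<close> with \<open>0 \<le> p \<le> 1\<close>. Nobody joins at a position beyond
  \<open>m + 1\<close>, so the states with at most \<open>m + 1\<close> customers form a closed linear system in which
  \<open>p\<close> enters only through the joining rate \<open>lam * p\<close> at \<open>m\<close> customers. The value \<open>p = 0\<close>
  gives \<open>beta\<close> at \<open>m\<close> and \<open>p = 1\<close> gives \<open>alpha\<close> at \<open>m + 1\<close>. If the waiting time
  \<open>W p\<close> at position \<open>m + 1\<close> is continuous and strictly increasing in \<open>p\<close>, the equilibrium
  threshold for a reward \<open>R\<close> is the unique \<open>m + p\<close> with \<open>W p = R\<close>, and a larger reward gives
  a larger \<open>p\<close>. At equilibrium the payoff at position \<open>m\<close> equals \<open>W p\<close> minus the waiting time at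
  position \<open>m\<close>. Hence the claim says that extra congestion costs the customer at position \<open>m\<close>
  strictly more than the one at position \<open>m + 1\<close>; this reduction is
  \<open>payoff_decreasing_from_increments\<close>.

  For \<open>m = 1\<close> the equations at two customers do not involve \<open>p\<close>, and they force the first
  waiting time to be an affine function of the second one with slope \<open>2 - q > 1\<close>
  (\<open>wait_one\<close>). For \<open>m = 2\<close> elimination expresses both the waiting time at position \<open>3\<close> and
  the difference of the waiting times at positions \<open>2\<close> and \<open>3\<close> through ratios of quadratic
  polynomials in \<open>t = lam * p / mu\<close> with a common denominator (\<open>wait_two\<close>). Such a ratio
  increases when the coefficients of the Wronskian of numerator and denominator are positive,
  and these coefficients turn out to be visibly positive when written in \<open>r = 1 - q\<close>
  (\<open>two_customer_ratios_less\<close>).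

  The waiting times are specified as the unique solution of a linear system, so the elimination
  is only meaningful once unique solvability is known. It holds for every threshold
  (\<open>waiting_equations_wait\<close>): uniqueness comes from a maximum principle, existence from monotone
  value iteration below an explicit supersolution.
\<close>

section \<open>Solvability of the waiting equations\<close>

lemma join_prob_bounds:
  assumes "x \<ge> 0"
  shows "0 \<le> join_prob x i" "join_prob x i \<le> 1"
  using assms by (auto simp: join_prob_def Let_def; linarith)+

lemma join_prob_beyond_top:
  assumes "x \<ge> 0" "j \<ge> nat \<lceil>x\<rceil> + 1"
  shows "join_prob x (j + 1) = 0"
proof -
  have "nat \<lfloor>x\<rfloor> \<le> nat \<lceil>x\<rceil>"
    by (simp add: nat_mono floor_le_ceiling)
  with assms(2) show ?thesis by (auto simp: join_prob_def Let_def)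
qed

lemma finite_queue_states: "finite (queue_states x)"
  by (rule finite_subset[of _ "{..nat \<lceil>x\<rceil> + 1} \<times> {..nat \<lceil>x\<rceil> + 1}"])
     (auto simp: queue_states_def)

text \<open>
  A maximum principle. The difference of two solutions solves the homogeneous equations, so each
  of its values is a subconvex combination of other values. Consider a state with the largest
  absolute value and, among those, with the smallest position. The service term there is strictly
  smaller: in position \<open>1\<close> because success has positive probability, elsewhere because a service
  always moves the tagged customer to a smaller position.
\<close>

lemma waiting_equations_unique:
  fixes w v :: "nat \<Rightarrow> nat \<Rightarrow> real"
  assumes "lam > 0" "mu > 0" "0 < q" "q < 1" "x \<ge> 0"
    and w: "waiting_equations lam mu q x w" and v: "waiting_equations lam mu q x v"
    and S: "(i, j) \<in> queue_states x"
  shows "w i j = v i j"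
proof (rule ccontr)
  assume neq: "w i j \<noteq> v i j"
  let ?S = "queue_states x"
  define d where "d = (\<lambda>i j. w i j - v i j)"
  define M where "M = Max ((\<lambda>(i, j). \<bar>d i j\<bar>) ` ?S)"
  have le_M: "\<bar>d k l\<bar> \<le> M" if "(k, l) \<in> ?S" for k l
    unfolding M_def using that finite_queue_states[of x] by (intro Max_ge) force+
  have "\<bar>d i j\<bar> > 0" using neq by (simp add: d_def)
  with le_M[OF S] have "M > 0" by linarith
  have "M \<in> (\<lambda>(i, j). \<bar>d i j\<bar>) ` ?S"
    unfolding M_def using S finite_queue_states[of x] by (intro Max_in) auto
  then have "\<exists>k l. (k, l) \<in> ?S \<and> \<bar>d k l\<bar> = M" by auto
  define k where "k = (LEAST k. \<exists>l. (k, l) \<in> ?S \<and> \<bar>d k l\<bar> = M)"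
  have "\<exists>l. (k, l) \<in> ?S \<and> \<bar>d k l\<bar> = M"
    unfolding k_def using \<open>\<exists>k l. (k, l) \<in> ?S \<and> \<bar>d k l\<bar> = M\<close> by (rule LeastI_ex)
  then obtain l where kl: "(k, l) \<in> ?S" "\<bar>d k l\<bar> = M" by blast
  have lt_M: "\<bar>d k' l'\<bar> < M" if "(k', l') \<in> ?S" "k' < k" for k' l'
    using le_M[OF that(1)] not_less_Least[OF that(2)[unfolded k_def]] that(1)
    by (force simp: order.strict_iff_order)
  define u where "u = join_prob x (l + 1)"
  have u: "0 \<le> u" "u \<le> 1" using join_prob_bounds[OF \<open>x \<ge> 0\<close>] by (auto simp: u_def)
  define s where "s = after_service q d k l"
  have eq: "(lam + mu) * d k l = lam * (u * d k (l + 1) + (1 - u) * d k l) + mu * s"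
  proof -
    have "(lam + mu) * w k l = 1 + lam * (u * w k (l + 1) + (1 - u) * w k l)
             + mu * after_service q w k l"
      using w kl(1) unfolding waiting_equations_def u_def by auto
    moreover have "(lam + mu) * v k l = 1 + lam * (u * v k (l + 1) + (1 - u) * v k l)
             + mu * after_service q v k l"
      using v kl(1) unfolding waiting_equations_def u_def by auto
    moreover have "s = after_service q w k l - after_service q v k l"
      by (simp add: s_def after_service_def d_def algebra_simps)
    then have "mu * s = mu * after_service q w k l - mu * after_service q v k l"
      by (simp add: right_diff_distrib)
    ultimately show ?thesis by (simp add: d_def algebra_simps)
  qed
  have up: "\<bar>u * d k (l + 1)\<bar> \<le> u * M"
  proof (cases "l + 1 \<le> nat \<lceil>x\<rceil> + 1")
    case True
    then have "(k, l + 1) \<in> ?S" using kl(1) by (auto simp: queue_states_def)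
    then show ?thesis using le_M u by (simp add: abs_mult mult_left_mono)
  next
    case False
    then have "u = 0" unfolding u_def using \<open>x \<ge> 0\<close> by (intro join_prob_beyond_top) auto
    then show ?thesis by simp
  qed
  have "\<bar>s\<bar> < M"
  proof (cases "k = 1")
    case True
    then have "\<bar>s\<bar> = (1 - q) * \<bar>d l l\<bar>"
      using \<open>q < 1\<close> by (simp add: s_def after_service_def abs_mult)
    also have "\<dots> \<le> (1 - q) * M"
      using kl(1) \<open>q < 1\<close> by (intro mult_left_mono le_M) (auto simp: queue_states_def)
    also have "\<dots> < M" using \<open>0 < q\<close> \<open>M > 0\<close> by (simp add: algebra_simps)
    finally show ?thesis .
  next
    case False
    then have k: "(k - 1, l - 1) \<in> ?S" "(k - 1, l) \<in> ?S" "k - 1 < k"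
      using kl(1) by (auto simp: queue_states_def)
    have "\<bar>s\<bar> \<le> \<bar>q * d (k - 1) (l - 1)\<bar> + \<bar>(1 - q) * d (k - 1) l\<bar>"
      using False by (simp add: s_def after_service_def abs_triangle_ineq)
    also have "\<dots> = q * \<bar>d (k - 1) (l - 1)\<bar> + (1 - q) * \<bar>d (k - 1) l\<bar>"
      using assms by (simp add: abs_mult)
    also have "\<dots> < q * M + (1 - q) * M"
      using lt_M[OF k(1,3)] lt_M[OF k(2,3)] assms
      by (intro add_strict_mono mult_strict_left_mono) auto
    finally show ?thesis by (simp add: algebra_simps)
  qed
  have "(lam + mu) * M = \<bar>lam * (u * d k (l + 1) + (1 - u) * d k l) + mu * s\<bar>"
    using eq kl(2) assms(1,2) by (metis abs_mult abs_of_pos add_pos_pos)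
  also have "\<dots> \<le> \<bar>lam * (u * d k (l + 1) + (1 - u) * d k l)\<bar> + \<bar>mu * s\<bar>"
    by (rule abs_triangle_ineq)
  also have "\<dots> = lam * \<bar>u * d k (l + 1) + (1 - u) * d k l\<bar> + mu * \<bar>s\<bar>"
    using assms(1,2) by (simp add: abs_mult)
  also have "\<dots> < lam * M + mu * M"
  proof (intro add_le_less_mono mult_left_mono mult_strict_left_mono)
    have "\<bar>u * d k (l + 1) + (1 - u) * d k l\<bar> \<le> \<bar>u * d k (l + 1)\<bar> + \<bar>(1 - u) * d k l\<bar>"
      by (rule abs_triangle_ineq)
    also have "\<dots> \<le> u * M + (1 - u) * M" using up u kl(2) by (simp add: abs_mult)
    finally show "\<bar>u * d k (l + 1) + (1 - u) * d k l\<bar> \<le> M" by (simp add: algebra_simps)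
  qed (use assms \<open>\<bar>s\<bar> < M\<close> in auto)
  finally show False by (simp add: algebra_simps)
qed

text \<open>
  The waiting equations say that \<open>w\<close> is a fixed point of this monotone operator; it vanishes
  outside the state space so that its fixed points are exactly the normalised solutions.
\<close>

definition wait_update ::
  "real \<Rightarrow> real \<Rightarrow> real \<Rightarrow> real \<Rightarrow> (nat \<Rightarrow> nat \<Rightarrow> real) \<Rightarrow> nat \<Rightarrow> nat \<Rightarrow> real" where
  "wait_update lam mu q x w i j =
     (if (i, j) \<in> queue_states x
      then (1 + lam * (join_prob x (j + 1) * w i (j + 1) + (1 - join_prob x (j + 1)) * w i j)
             + mu * after_service q w i j) / (lam + mu)
      else 0)"

lemma wait_update_mono:
  assumes "lam > 0" "mu > 0" "0 < q" "q < 1" "x \<ge> 0" and "\<And>i j. w i j \<le> v i j"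
  shows "wait_update lam mu q x w i j \<le> wait_update lam mu q x v i j"
  using assms join_prob_bounds[OF \<open>x \<ge> 0\<close>, of "j + 1"]
  unfolding wait_update_def after_service_def
  by (auto intro!: divide_right_mono add_mono mult_left_mono)

text \<open>
  A bound that ignores the number of customers suffices. A slope of \<open>1 / mu\<close> in the position pays
  for one service. In position \<open>1\<close> a failed service leads back to some position at most \<open>J\<close>, and
  the constant \<open>C\<close> is chosen so large that \<open>mu * q * C\<close>, the gain from a possible success, pays
  for this setback.
\<close>

lemma wait_update_supersolution:
  fixes lam mu q x :: real
  assumes "lam > 0" "mu > 0" "0 < q" "q < 1" "x \<ge> 0"
  obtains f :: "nat \<Rightarrow> nat \<Rightarrow> real"
  where "\<And>i j. 0 \<le> f i j" "\<And>i j. wait_update lam mu q x f i j \<le> f i j"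
proof -
  define J where "J = real (nat \<lceil>x\<rceil> + 1)"
  define C where "C = (1 + (1 - q) * J) / (mu * q)"
  define f :: "nat \<Rightarrow> nat \<Rightarrow> real" where "f = (\<lambda>i j. C + real i / mu)"
  have "J \<ge> 0" by (simp add: J_def)
  then have "C \<ge> 0" using assms by (simp add: C_def)
  then have nonneg: "0 \<le> f i j" for i j using assms by (simp add: f_def)
  have C: "mu * q * C = 1 + (1 - q) * J" using assms by (simp add: C_def)
  have "wait_update lam mu q x f i j \<le> f i j" for i j
  proof (cases "(i, j) \<in> queue_states x")
    case False
    then show ?thesis using nonneg by (simp add: wait_update_def)
  next
    case True
    have "1 + mu * after_service q f i j \<le> mu * f i j"
    proof (cases "i = 1")
      case True
      have "real j \<le> J" using \<open>(i, j) \<in> _\<close> by (auto simp: J_def queue_states_def)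
      then have "(1 - q) * real j \<le> (1 - q) * J" using assms by (intro mult_left_mono) auto
      with C have "(1 - q) * real j \<le> q * (mu * C)" by (simp add: algebra_simps)
      then have "1 + (1 - q) * (mu * C + real j) \<le> mu * C + 1" by (simp add: algebra_simps)
      moreover have "mu * after_service q f i j = (1 - q) * (mu * C + real j)"
        "mu * f i j = mu * C + 1"
        using True assms by (simp_all add: after_service_def f_def field_simps)
      ultimately show ?thesis by simp
    next
      case False
      then have "real (i - 1) = real i - 1" using True by (auto simp: queue_states_def)
      then show ?thesis using False assms by (simp add: after_service_def f_def field_simps)
    qed
    moreover have level:
      "join_prob x (j + 1) * f i (j + 1) + (1 - join_prob x (j + 1)) * f i j = f i j"
      by (simp add: f_def algebra_simps)
    ultimately have "1 + lam * (join_prob x (j + 1) * f i (j + 1) + (1 - join_prob x (j + 1)) * f i j)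
             + mu * after_service q f i j \<le> (lam + mu) * f i j"
      unfolding level by (simp add: algebra_simps)
    then show ?thesis using True assms by (simp add: wait_update_def field_simps)
  qed
  with nonneg show ?thesis by (rule that)
qed

lemma waiting_equations_exist:
  fixes lam mu q x :: real
  assumes "lam > 0" "mu > 0" "0 < q" "q < 1" "x \<ge> 0"
  obtains w where "waiting_equations lam mu q x w" "\<And>i j. (i, j) \<notin> queue_states x \<Longrightarrow> w i j = 0"
proof -
  let ?T = "wait_update lam mu q x"
  obtain f where f: "\<And>i j. 0 \<le> f i j" "\<And>i j. ?T f i j \<le> f i j"
    using wait_update_supersolution[OF assms] by blast
  define g :: "nat \<Rightarrow> nat \<Rightarrow> nat \<Rightarrow> real" where "g = (\<lambda>n. (?T ^^ n) (\<lambda>_ _. 0))"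
  have g_Suc: "g (Suc n) = ?T (g n)" for n by (simp add: g_def)
  have g0: "g 0 i j = 0" for i j by (simp add: g_def)
  have T0: "0 \<le> ?T (\<lambda>_ _. 0) i j" for i j
    using assms by (simp add: wait_update_def after_service_def)
  have le_f: "g n i j \<le> f i j" for n i j
  proof (induction n arbitrary: i j)
    case 0 then show ?case using f by (simp add: g0)
  next
    case (Suc n)
    have "?T (g n) i j \<le> ?T f i j" by (rule wait_update_mono[OF assms Suc.IH])
    with f(2)[of i j] show ?case by (simp add: g_Suc)
  qed
  have step: "g n i j \<le> g (Suc n) i j" for n i j
  proof (induction n arbitrary: i j)
    case 0
    have "g 0 = (\<lambda>_ _. 0)" by (simp add: g_def)
    then show ?case using T0 by (simp only: g_Suc)
  next
    case (Suc n)
    have "?T (g n) i j \<le> ?T (g (Suc n)) i j" by (rule wait_update_mono[OF assms Suc.IH])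
    then show ?case by (simp only: g_Suc)
  qed
  define w where "w = (\<lambda>i j. lim (\<lambda>n. g n i j))"
  have lim: "(\<lambda>n. g n i j) \<longlonglongrightarrow> w i j" for i j
  proof -
    have "incseq (\<lambda>n. g n i j)" using step by (intro incseq_SucI)
    then obtain L where "(\<lambda>n. g n i j) \<longlonglongrightarrow> L"
      by (rule incseq_convergent[where B = "f i j"]) (use le_f in auto)
    then show ?thesis unfolding w_def by (metis limI)
  qed
  have fixpoint: "w i j = ?T w i j" for i j
  proof (rule LIMSEQ_unique)
    show "(\<lambda>n. g (Suc n) i j) \<longlonglongrightarrow> w i j" using lim by (rule LIMSEQ_Suc)
    show "(\<lambda>n. g (Suc n) i j) \<longlonglongrightarrow> ?T w i j"
      using assms unfolding g_Suc wait_update_def after_service_def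
      by (auto intro!: tendsto_intros lim)
  qed
  show ?thesis
  proof
    show "waiting_equations lam mu q x w"
      unfolding waiting_equations_def
    proof clarify
      fix i j assume "(i, j) \<in> queue_states x"
      then show "(lam + mu) * w i j =
          1 + lam * (join_prob x (j + 1) * w i (j + 1) + (1 - join_prob x (j + 1)) * w i j)
            + mu * after_service q w i j"
        using fixpoint[of i j] assms by (simp add: wait_update_def eq_divide_eq mult.commute)
    qed
    show "w i j = 0" if "(i, j) \<notin> queue_states x" for i j
      using fixpoint[of i j] that by (simp add: wait_update_def)
  qed
qed

lemma waiting_equations_wait:
  assumes "lam > 0" "mu > 0" "0 < q" "q < 1" "x \<ge> 0"
  shows "waiting_equations lam mu q x (wait lam mu q x)"
proof -
  have "\<exists>!w. waiting_equations lam mu q x w \<and> (\<forall>i j. (i, j) \<notin> queue_states x \<longrightarrow> w i j = 0)"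
  proof (rule ex_ex1I)
    show "\<exists>w. waiting_equations lam mu q x w \<and> (\<forall>i j. (i, j) \<notin> queue_states x \<longrightarrow> w i j = 0)"
      using waiting_equations_exist[OF assms] by metis
  next
    fix w v
    assume w: "waiting_equations lam mu q x w \<and> (\<forall>i j. (i, j) \<notin> queue_states x \<longrightarrow> w i j = 0)"
      and v: "waiting_equations lam mu q x v \<and> (\<forall>i j. (i, j) \<notin> queue_states x \<longrightarrow> v i j = 0)"
    show "w = v"
    proof (intro ext)
      fix i j show "w i j = v i j"
        using w v waiting_equations_unique[OF assms, of w v i j] by (cases "(i, j) \<in> queue_states x") auto
    qed
  qed
  from theI'[OF this] show ?thesis unfolding wait_def by blast
qed

section \<open>The states that determine the waiting time at the threshold\<close>

lemma join_prob_add: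
  assumes "0 \<le> p" "p \<le> 1"
  shows "join_prob (real m + p) i = (if i \<le> m then 1 else if i = m + 1 then p else 0)"
proof (cases "p = 1")
  case True
  have "nat \<lfloor>real m + 1\<rfloor> = m + 1"
    by (metis floor_of_nat nat_int of_nat_1 of_nat_add)
  with True show ?thesis by (auto simp: join_prob_def Let_def)
next
  case False
  then have "\<lfloor>real m + p\<rfloor> = int m" using assms by (simp add: floor_unique)
  then show ?thesis by (auto simp: join_prob_def Let_def)
qed

text \<open>
  For \<open>p = 0\<close> and \<open>p = 1\<close> the threshold is an integer, and the state space \<open>queue_states\<close> has a
  different size for \<open>p = 0\<close> than for \<open>p > 0\<close>. Restricting to at most \<open>m + 1\<close> customers gives
  one system for the whole closed interval, and so makes \<open>beta\<close> and \<open>alpha\<close> the end points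
  of a single continuous family.
\<close>

lemma wait_closed_system:
  assumes "lam > 0" "mu > 0" "0 < q" "q < 1" "0 \<le> p" "p \<le> 1" "1 \<le> i" "i \<le> j" "j \<le> m + 1"
  defines "w \<equiv> wait lam mu q (real m + p)"
  defines "a \<equiv> (if j < m then lam else if j = m then lam * p else 0)"
  shows "(a + mu) * w i j = 1 + a * w i (j + 1) + mu * after_service q w i j"
proof -
  have "int m \<le> \<lceil>real m + p\<rceil>" using assms by linarith
  then have "(i, j) \<in> queue_states (real m + p)"
    using assms by (auto simp: queue_states_def)
  with waiting_equations_wait[OF assms(1-4), of "real m + p"] assms(5)
  have "(lam + mu) * w i j = 1 + lam * (join_prob (real m + p) (j + 1) * w i (j + 1)
          + (1 - join_prob (real m + p) (j + 1)) * w i j) + mu * after_service q w i j"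
    unfolding waiting_equations_def w_def by auto
  moreover have "join_prob (real m + p) (j + 1) = (if j < m then 1 else if j = m then p else 0)"
    unfolding join_prob_add[OF assms(5,6)] by auto
  ultimately show ?thesis
    by (auto simp: a_def algebra_simps split: if_splits)
qed

lemma payoff_decreasing_from_increments:
  fixes lam mu q :: real and m :: nat
  defines "W \<equiv> \<lambda>p. wait lam mu q (real m + p)"
  assumes cont: "continuous_on {0..1} (\<lambda>p. W p (m + 1) (m + 1))"
    and mono: "\<And>p s. 0 \<le> p \<Longrightarrow> p < s \<Longrightarrow> s \<le> 1 \<Longrightarrow> W p (m + 1) (m + 1) < W s (m + 1) (m + 1)"
    and incr: "\<And>p s. 0 \<le> p \<Longrightarrow> p < s \<Longrightarrow> s \<le> 1 \<Longrightarrow>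
                 W s (m + 1) (m + 1) - W p (m + 1) (m + 1) < W s m m - W p m m"
    and r: "beta lam mu q m < r1" "r1 < r2" "r2 < alpha lam mu q (m + 1)"
  shows "payoff lam mu q r1 (nash_threshold lam mu q m r1) m m
       > payoff lam mu q r2 (nash_threshold lam mu q m r2) m m"
proof -
  let ?F = "\<lambda>p. W p (m + 1) (m + 1)"
  have ends: "?F 0 = beta lam mu q m" "?F 1 = alpha lam mu q (m + 1)"
    by (simp_all add: W_def alpha_def beta_def add.commute)
  \<comment> \<open>The definition of the threshold by \<open>THE\<close> says something only if a unique solution exists.\<close>
  have nash: "\<exists>p. 0 < p \<and> p < 1 \<and> ?F p = R \<and> nash_threshold lam mu q m R = real m + p"
    if R: "beta lam mu q m < R" "R < alpha lam mu q (m + 1)" for R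
  proof -
    obtain p where p: "0 \<le> p" "p \<le> 1" "?F p = R"
      using IVT'[of ?F 0 R 1] cont R ends by force
    have "p \<noteq> 0" "p \<noteq> 1" using p R ends by auto
    have "nash_threshold lam mu q m R = real m + p"
      unfolding nash_threshold_def
    proof (rule the_equality)
      show "real m + p \<in> {real m<..<real (m + 1)} \<and> wait lam mu q (real m + p) (m + 1) (m + 1) = R"
        using p \<open>p \<noteq> 0\<close> \<open>p \<noteq> 1\<close> by (simp add: W_def)
    next
      fix x assume x: "x \<in> {real m<..<real (m + 1)} \<and> wait lam mu q x (m + 1) (m + 1) = R"
      define s where "s = x - real m"
      have s: "0 < s" "s < 1" "?F s = R" using x by (auto simp: s_def W_def)
      have "s = p" using mono[of s p] mono[of p s] s p by force
      then show "x = real m + p" by (simp add: s_def)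
    qed
    with p \<open>p \<noteq> 0\<close> \<open>p \<noteq> 1\<close> show ?thesis by force
  qed
  from nash[of r1] r obtain p where p: "0 < p" "p < 1" "?F p = r1"
    "nash_threshold lam mu q m r1 = real m + p" by auto
  from nash[of r2] r obtain s where s: "0 < s" "s < 1" "?F s = r2"
    "nash_threshold lam mu q m r2 = real m + s" by auto
  have "p < s"
  proof (rule ccontr)
    assume "\<not> p < s"
    then have "?F s \<le> ?F p" using mono[of s p] p s by (cases "s = p") auto
    with p s r show False by linarith
  qed
  from incr[OF _ this] p s show ?thesis by (simp add: payoff_def W_def)
qed

section \<open>Monotonicity of ratios of quadratics\<close>

text \<open>
  The three sign conditions concern the coefficients of \<open>N' * D - N * D'\<close> for the numerator \<open>N\<close>
  and the denominator \<open>D\<close>, up to positive factors. The same coefficients appear in the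
  cross-multiplied difference after division by \<open>t - s\<close>, which avoids differentiation.
\<close>

lemma quadratic_ratio_less:
  fixes a0 a1 a2 d0 d1 d2 s t :: real
  assumes d: "0 < d0" "0 \<le> d1" "0 \<le> d2"
    and w: "0 \<le> a2 * d1 - a1 * d2" "0 \<le> a2 * d0 - a0 * d2" "0 < a1 * d0 - a0 * d1"
    and st: "0 \<le> s" "s < t"
  shows "(a2 * s\<^sup>2 + a1 * s + a0) / (d2 * s\<^sup>2 + d1 * s + d0)
       < (a2 * t\<^sup>2 + a1 * t + a0) / (d2 * t\<^sup>2 + d1 * t + d0)"
proof -
  have pos: "0 < d2 * u\<^sup>2 + d1 * u + d0" if "0 \<le> u" for u
    using d that by (intro add_nonneg_pos add_nonneg_nonneg) auto
  have "0 < (t - s) * ((a2 * d1 - a1 * d2) * (s * t) + (a2 * d0 - a0 * d2) * (s + t)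
              + (a1 * d0 - a0 * d1))"
    using w st by (intro mult_pos_pos add_nonneg_pos add_nonneg_nonneg mult_nonneg_nonneg) auto
  also have "\<dots> = (a2 * t\<^sup>2 + a1 * t + a0) * (d2 * s\<^sup>2 + d1 * s + d0)
              - (a2 * s\<^sup>2 + a1 * s + a0) * (d2 * t\<^sup>2 + d1 * t + d0)"
    by (simp add: power2_eq_square algebra_simps)
  finally show ?thesis using pos[of s] pos[of t] st by (simp add: frac_less_eq divide_less_0_iff)
qed

section \<open>Thresholds between one and two\<close>

text \<open>
  The affine relation uses only the equations with two customers in the system. The equation with
  one customer, the only one that contains \<open>t\<close>, then determines the position on this line.
\<close>

lemma wait_one:
  fixes lam mu q p :: real
  assumes "lam > 0" "mu > 0" "0 < q" "q < 1" "0 \<le> p" "p \<le> 1"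
  defines "w \<equiv> wait lam mu q (1 + p)" and "t \<equiv> lam * p / mu" and "r \<equiv> 1 - q"
  shows "w 2 2 = (2 / q * t + (2 + r)) / (t + q * (1 + r)) / mu"
    and "w 1 1 = (1 + r) * (w 2 2 - 1 / (mu * q))"
proof -
  note eq = wait_closed_system[OF assms(1-6), where m = 1, simplified, folded w_def]
  have q: "q = 1 - r" by (simp add: r_def)
  define a b c where "a = mu * w 1 1" and "b = mu * w 1 2" and "c = mu * w 2 2"
  have lp: "lam * p = t * mu" using assms by (simp add: t_def)
  have e11: "(t + q) * a = 1 + t * b"
    using eq[of 1 1] by (simp add: after_service_def a_def b_def lp q numeral_2_eq_2 algebra_simps)
  have e12: "b = 1 + r * c"
    using eq[of 1 2] by (simp add: after_service_def a_def b_def c_def q algebra_simps)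
  have e22: "c = 1 + q * a + r * b"
    using eq[of 2 2] by (simp add: after_service_def a_def b_def c_def q algebra_simps)
  have "t \<ge> 0" using assms by (simp add: t_def)
  have "q * a = (1 + r) * (q * c - 1)"
    using e22 e12 unfolding q by (simp add: algebra_simps)
  then have a: "a = (1 + r) * (c - 1 / q)" using assms by (simp add: field_simps)
  have "(t + q) * (q * a) = q * ((t + q) * a)" by simp
  also have "\<dots> = q + q * t * (1 + r * c)"
    unfolding e11 e12 by (simp add: algebra_simps)
  finally have "(t + q) * ((1 + r) * (q * c - 1)) = q + q * t * (1 + r * c)"
    by (simp only: \<open>q * a = _\<close>)
  then have "q * (c * (t + q * (1 + r))) = 2 * t + q * (2 + r)"
    unfolding q by (simp add: algebra_simps)
  also have "\<dots> = q * (2 / q * t + (2 + r))" using \<open>0 < q\<close> by (simp add: field_simps)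
  finally have "c * (t + q * (1 + r)) = 2 / q * t + (2 + r)" using \<open>0 < q\<close> by simp
  moreover have "t + q * (1 + r) > 0"
    using \<open>t \<ge> 0\<close> assms by (intro add_nonneg_pos mult_pos_pos) (auto simp: r_def)
  ultimately have c: "c = (2 / q * t + (2 + r)) / (t + q * (1 + r))"
    by (simp add: eq_divide_eq)
  show "w 2 2 = (2 / q * t + (2 + r)) / (t + q * (1 + r)) / mu"
    using \<open>0 < mu\<close> unfolding c[symmetric] c_def by simp
  show "w 1 1 = (1 + r) * (w 2 2 - 1 / (mu * q))"
    using a assms by (simp add: a_def c_def field_simps)
qed

lemma payoff_decreasing_one:
  fixes lam mu q :: real
  assumes "lam > 0" "mu > 0" "0 < q" "q < 1"
    and r: "beta lam mu q 1 < r1" "r1 < r2" "r2 < alpha lam mu q 2"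
  shows "payoff lam mu q r1 (nash_threshold lam mu q 1 r1) 1 1
       > payoff lam mu q r2 (nash_threshold lam mu q 1 r2) 1 1"
proof -
  note w = wait_one[OF assms(1-4)]
  have mono: "wait lam mu q (1 + p) 2 2 < wait lam mu q (1 + s) 2 2"
    if "0 \<le> p" "p < s" "s \<le> 1" for p s
  proof -
    let ?f = "\<lambda>t. (2 / q * t + (2 + (1 - q))) / (t + q * (1 + (1 - q)))"
    have "lam * p / mu < lam * s / mu" using that assms by (simp add: divide_strict_right_mono)
    then have "?f (lam * p / mu) < ?f (lam * s / mu)"
      using quadratic_ratio_less[of "q * (2 - q)" 1 0 0 "2 / q" "3 - q" "lam * p / mu" "lam * s / mu"]
        that assms by simp
    then have "?f (lam * p / mu) / mu < ?f (lam * s / mu) / mu"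
      using assms by (intro divide_strict_right_mono)
    then show ?thesis using w(1)[of p] w(1)[of s] that by simp
  qed
  have cont: "continuous_on {0..1} (\<lambda>p. wait lam mu q (1 + p) 2 2)"
  proof -
    have "lam * p / mu + q * (1 + (1 - q)) \<noteq> 0" if "p \<in> {0..1}" for p
      using that assms by (intro less_imp_neq[symmetric] add_nonneg_pos mult_pos_pos) auto
    then have "continuous_on {0..1} (\<lambda>p. (2 / q * (lam * p / mu) + (2 + (1 - q)))
        / (lam * p / mu + q * (1 + (1 - q))) / mu)"
      using assms by (intro continuous_intros) auto
    then show ?thesis by (rule continuous_on_eq) (use w(1) in auto)
  qed
  have incr: "wait lam mu q (1 + s) 2 2 - wait lam mu q (1 + p) 2 2
      < wait lam mu q (1 + s) 1 1 - wait lam mu q (1 + p) 1 1"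
    if "0 \<le> p" "p < s" "s \<le> 1" for p s
  proof -
    have "0 < (1 - q) * (wait lam mu q (1 + s) 2 2 - wait lam mu q (1 + p) 2 2)"
      using mono[OF that] assms by simp
    also have "\<dots> = wait lam mu q (1 + s) 1 1 - wait lam mu q (1 + p) 1 1
        - (wait lam mu q (1 + s) 2 2 - wait lam mu q (1 + p) 2 2)"
      using w(2)[of p] w(2)[of s] that by (simp add: algebra_simps)
    finally show ?thesis by simp
  qed
  show ?thesis
    using payoff_decreasing_from_increments[of lam mu q 1 r1 r2, unfolded one_add_one of_nat_1]
      cont mono incr r by blast
qed

section \<open>Thresholds between two and three\<close>

text \<open>
  The waiting times are measured in mean service times. Every customer needs \<open>1 / q\<close> services on
  average, and the excess \<open>X = w33 - 1 / q\<close> is the convenient unknown: the constant terms of the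
  equations with three customers are absorbed by it, and these equations become
  \<open>(1 + r + r\<^sup>2) * X = w22 + r * w12\<close>. The other equations reduce to two linear equations for
  \<open>X\<close> and \<open>w12\<close>, and \<open>D\<close> is their determinant. Moreover \<open>w22 - w33 = r * H - 1 / q\<close> for
  \<open>H = (1 + r) * X - w12\<close>, so the comparison of the two positions is governed by one more
  quotient with the denominator \<open>D\<close>. The state with one customer enters
  only through \<open>q * w11 = y + (q - q * y) * w12\<close>, which explains the choice of \<open>y\<close>.
\<close>

lemma two_customer_elimination:
  fixes l q t w11 w12 w22 w13 w23 w33 :: real
  defines "r \<equiv> 1 - q" and "y \<equiv> q / (l + q)"
  defines "D \<equiv> t\<^sup>2 + (2 + r * q * y) * t + (1 + r + r\<^sup>2) * q * (1 + r * y)"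
  assumes pos: "0 < l" "0 < q" "q < 1" "0 \<le> t"
    and e11: "(l + q) * w11 = 1 + l * w12"
    and e12: "(t + 1) * w12 = 1 + t * w13 + r * w22"
    and e22: "(t + 1) * w22 = 1 + t * w23 + q * w11 + r * w12"
    and e13: "w13 = 1 + r * w33"
    and e23: "w23 = 1 + q * w12 + r * w13"
    and e33: "w33 = 1 + q * w22 + r * w23"
  shows "w33 = 1 / q + (2 / q * t\<^sup>2 + (4 - r + r\<^sup>2) / q * t + (2 + r + r\<^sup>2 + y * r * (1 + r))) / D"
    and "w22 - w33 = r * ((1 / q * t\<^sup>2 + (2 / q - r * y) * t + (1 + r + r\<^sup>2 * y)) / D) - 1 / q"
proof -
  define k where "k = 1 / q"
  define X where "X = w33 - k"
  define c where "c = 1 + r + r\<^sup>2"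
  define H where "H = (1 + r) * X - w12"
  define M where "M = t + 1 + r\<^sup>2"
  have q: "q = 1 - r" by (simp add: r_def)
  have kq: "k * q = 1" using pos by (simp add: k_def)
  have "y \<ge> 0" "r > 0" using pos by (auto simp: y_def r_def)
  have y: "y * (l + q) = q" using pos by (simp add: y_def)
  have w11: "q * w11 = y + (q - q * y) * w12"
  proof -
    have "q * w11 = y * ((l + q) * w11)" using y by simp
    also have "\<dots> = y + (y * (l + q) - q * y) * w12" unfolding e11 by (simp add: algebra_simps)
    finally show ?thesis unfolding y .
  qed
  have w33: "w33 = X + k" by (simp add: X_def)
  have w13: "w13 = k + r * X" using e13 kq unfolding w33 q by (simp add: algebra_simps)
  have "q * (c * X) = q * (w22 + r * w12)"
    using e33 kq unfolding e23 w13 w33 q c_def by algebra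
  then have X: "c * X = w22 + r * w12" using pos by simp
  have w23: "w23 = k + q * w12 + r\<^sup>2 * X"
    using e23 kq unfolding w13 q by algebra
  have w12: "M * w12 = 1 + t * k + r * (t + c) * X"
    using e12 X unfolding w13 M_def by algebra
  have w22: "X * (t * (1 + r) + c) = 1 + t * k + y + (t + 1 + r - q * y) * w12"
    using e22 X w23 w11 q unfolding c_def by algebra
  have "X * (M * (t * (1 + r) + c) - r * (t + c) * (t + 1 + r - q * y))
      = M * (1 + t * k + y) + (t + 1 + r - q * y) * (1 + t * k)"
    using w12 w22 by algebra
  moreover have "M * (t * (1 + r) + c) - r * (t + c) * (t + 1 + r - q * y) = D"
    unfolding M_def D_def c_def q by algebra
  moreover have "M * (1 + t * k + y) + (t + 1 + r - q * y) * (1 + t * k)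
      = 2 * k * t\<^sup>2 + (4 - r + r\<^sup>2) * k * t + (2 + r + r\<^sup>2 + y * r * (1 + r))"
    using kq unfolding M_def q by algebra
  ultimately have XD: "X * D = 2 * k * t\<^sup>2 + (4 - r + r\<^sup>2) * k * t + (2 + r + r\<^sup>2 + y * r * (1 + r))"
    by simp
  have "D > 0"
    unfolding D_def using pos \<open>y \<ge> 0\<close> \<open>r > 0\<close>
    by (intro add_nonneg_pos add_nonneg_nonneg mult_pos_pos mult_nonneg_nonneg add_pos_nonneg) auto
  with XD show "w33 = 1 / q + (2 / q * t\<^sup>2 + (4 - r + r\<^sup>2) / q * t
      + (2 + r + r\<^sup>2 + y * r * (1 + r))) / D"
    unfolding w33 k_def by (simp add: eq_divide_eq)
  have "M > 0" using pos by (simp add: M_def add_nonneg_pos add_pos_nonneg)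
  have MH: "M * H = (t + 1) * X - (1 + t * k)"
    using w12 unfolding H_def M_def c_def by algebra
  \<comment> \<open>Since \<open>M * H\<close> depends on \<open>X\<close> alone, \<open>w12\<close> need not be computed.\<close>
  have "M * (H * D) = M * (k * t\<^sup>2 + (2 * k - r * y) * t + (1 + r + r\<^sup>2 * y))"
  proof -
    have "M * (H * D) = (t + 1) * (X * D) - (1 + t * k) * D"
      using MH by algebra
    also have "\<dots> = M * (k * t\<^sup>2 + (2 * k - r * y) * t + (1 + r + r\<^sup>2 * y))"
      using kq unfolding XD unfolding M_def D_def q by algebra
    finally show ?thesis .
  qed
  with \<open>M > 0\<close> have "H * D = k * t\<^sup>2 + (2 * k - r * y) * t + (1 + r + r\<^sup>2 * y)" by simp
  with \<open>D > 0\<close> have "H = (1 / q * t\<^sup>2 + (2 / q - r * y) * t + (1 + r + r\<^sup>2 * y)) / D"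
    unfolding k_def by (simp add: eq_divide_eq)
  moreover have "w22 - w33 = r * H - k"
    using X unfolding w33 H_def c_def by algebra
  ultimately show "w22 - w33
      = r * ((1 / q * t\<^sup>2 + (2 / q - r * y) * t + (1 + r + r\<^sup>2 * y)) / D) - 1 / q"
    by (simp add: k_def)
qed

lemma wait_two:
  fixes lam mu q p :: real
  assumes "lam > 0" "mu > 0" "0 < q" "q < 1" "0 \<le> p" "p \<le> 1"
  defines "w \<equiv> wait lam mu q (2 + p)" and "t \<equiv> lam * p / mu" and "r \<equiv> 1 - q"
    and "y \<equiv> q / (lam / mu + q)"
  defines "D \<equiv> t\<^sup>2 + (2 + r * q * y) * t + (1 + r + r\<^sup>2) * q * (1 + r * y)"
  shows "w 3 3 = (1 / q + (2 / q * t\<^sup>2 + (4 - r + r\<^sup>2) / q * t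
                            + (2 + r + r\<^sup>2 + y * r * (1 + r))) / D) / mu"
    and "w 2 2 - w 3 3
          = (r * ((1 / q * t\<^sup>2 + (2 / q - r * y) * t + (1 + r + r\<^sup>2 * y)) / D) - 1 / q) / mu"
proof -
  note eq = wait_closed_system[OF assms(1-6), where m = 2, simplified, folded w_def]
  define l where "l = lam / mu"
  define v where "v = (\<lambda>i j. mu * w i j)"
  have lam: "lam = l * mu" and lp: "lam * p = t * mu" using \<open>0 < mu\<close> by (simp_all add: l_def t_def)
  have pos: "0 < l" "0 < q" "q < 1" "0 \<le> t"
    using assms(1-6) by (simp_all add: l_def t_def)
  have e11: "(l + q) * v 1 1 = 1 + l * v 1 2"
    using eq[of 1 1] by (simp add: after_service_def v_def lam numeral_2_eq_2 algebra_simps)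
  have e12: "(t + 1) * v 1 2 = 1 + t * v 1 3 + (1 - q) * v 2 2"
    using eq[of 1 2] by (simp add: after_service_def v_def lp numeral_2_eq_2 numeral_3_eq_3 algebra_simps)
  have e22: "(t + 1) * v 2 2 = 1 + t * v 2 3 + q * v 1 1 + (1 - q) * v 1 2"
    using eq[of 2 2] by (simp add: after_service_def v_def lp numeral_2_eq_2 numeral_3_eq_3 algebra_simps)
  have e13: "v 1 3 = 1 + (1 - q) * v 3 3"
    using eq[of 1 3] by (simp add: after_service_def v_def algebra_simps)
  have e23: "v 2 3 = 1 + q * v 1 2 + (1 - q) * v 1 3"
    using eq[of 2 3] by (simp add: after_service_def v_def algebra_simps)
  have e33: "v 3 3 = 1 + q * v 2 2 + (1 - q) * v 2 3"
    using eq[of 3 3] by (simp add: after_service_def v_def algebra_simps)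
  note sol = two_customer_elimination[OF pos e11 e12 e22 e13 e23 e33, folded r_def,
      unfolded l_def, folded y_def, folded D_def]
  have "w 3 3 = v 3 3 / mu" "w 2 2 - w 3 3 = (v 2 2 - v 3 3) / mu"
    using \<open>0 < mu\<close> by (simp_all add: v_def diff_divide_distrib)
  then show "w 3 3 = (1 / q + (2 / q * t\<^sup>2 + (4 - r + r\<^sup>2) / q * t
                            + (2 + r + r\<^sup>2 + y * r * (1 + r))) / D) / mu"
    and "w 2 2 - w 3 3
          = (r * ((1 / q * t\<^sup>2 + (2 / q - r * y) * t + (1 + r + r\<^sup>2 * y)) / D) - 1 / q) / mu"
    unfolding sol(2) by (simp_all only: sol(1))
qed

text \<open>
  Here the inequality of the theorem is decided for \<open>m = 2\<close>. Rewriting the Wronskian coefficients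
  in \<open>r\<close> and \<open>y\<close> makes the terms without \<open>r\<close> cancel, and the only negative monomials left carry the
  factor \<open>y\<^sup>2\<close>; the bound \<open>y \<le> 1\<close> lets the pure powers of \<open>r\<close> dominate them.
\<close>

lemma two_customer_ratios_less:
  fixes q y s t :: real
  assumes q: "0 < q" "q < 1" and y: "0 \<le> y" "y \<le> 1" and st: "0 \<le> s" "s < t"
  defines "r \<equiv> 1 - q"
  defines "D \<equiv> \<lambda>t. t\<^sup>2 + (2 + r * q * y) * t + (1 + r + r\<^sup>2) * q * (1 + r * y)"
  defines "N \<equiv> \<lambda>t. 2 / q * t\<^sup>2 + (4 - r + r\<^sup>2) / q * t + (2 + r + r\<^sup>2 + y * r * (1 + r))"
    and "K \<equiv> \<lambda>t. 1 / q * t\<^sup>2 + (2 / q - r * y) * t + (1 + r + r\<^sup>2 * y)"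
  shows "N s / D s < N t / D t" and "K s / D s < K t / D t"
proof -
  have r: "0 < r" "r < 1" and q_r: "q = 1 - r" using q by (auto simp: r_def)
  define k where "k = 1 / q"
  have kq: "k * q = 1" using q by (simp add: k_def)
  have y2: "y\<^sup>2 \<le> 1" using y by (simp add: power_le_one)
  have d: "0 < (1 + r + r\<^sup>2) * q * (1 + r * y)" "0 \<le> 2 + r * q * y"
    using r q y by (auto intro!: mult_pos_pos add_pos_nonneg)
  have "2 * k * (2 + r * q * y) - (4 - r + r\<^sup>2) * k = r + 2 * r * y"
    using kq unfolding q_r by algebra
  then have N1: "0 \<le> 2 * k * (2 + r * q * y) - (4 - r + r\<^sup>2) * k * 1" using r y by simp
  have "2 * k * ((1 + r + r\<^sup>2) * q * (1 + r * y)) - (2 + r + r\<^sup>2 + y * r * (1 + r))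
      = r + r\<^sup>2 + r * y * (1 + r + 2 * r\<^sup>2)"
    using kq unfolding q_r by algebra
  also have "\<dots> \<ge> 0" using r y by simp
  finally have N2: "0 \<le> 2 * k * ((1 + r + r\<^sup>2) * q * (1 + r * y)) - (2 + r + r\<^sup>2 + y * r * (1 + r)) * 1"
    by simp
  have "(4 - r + r\<^sup>2) * k * ((1 + r + r\<^sup>2) * q * (1 + r * y))
        - (2 + r + r\<^sup>2 + y * r * (1 + r)) * (2 + r * q * y)
      = r + (r\<^sup>2 + r ^ 4) + (r\<^sup>2 * (1 - y\<^sup>2) + r ^ 4 * y\<^sup>2)
          + y * (2 * r\<^sup>2 + 4 * r ^ 3 + r ^ 4 + r ^ 5)"
    using kq unfolding q_r by algebra
  also have "\<dots> > 0"
    by (intro add_pos_nonneg add_nonneg_nonneg mult_nonneg_nonneg) (use r y y2 in simp_all)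
  finally have N3: "0 < (4 - r + r\<^sup>2) * k * ((1 + r + r\<^sup>2) * q * (1 + r * y))
        - (2 + r + r\<^sup>2 + y * r * (1 + r)) * (2 + r * q * y)" .
  show "N s / D s < N t / D t"
    using quadratic_ratio_less[OF d zero_le_one N1 N2 N3 st] by (simp add: N_def D_def k_def)
  have "k * (2 + r * q * y) - (2 * k - r * y) = 2 * r * y"
    using kq by algebra
  also have "\<dots> \<ge> 0" using r y by simp
  finally have K1: "0 \<le> k * (2 + r * q * y) - (2 * k - r * y) * 1" by simp
  have "k * ((1 + r + r\<^sup>2) * q * (1 + r * y)) - (1 + r + r\<^sup>2 * y) = r\<^sup>2 + r * y * (1 + r\<^sup>2)"
    using kq by algebra
  also have "\<dots> \<ge> 0" using r y by simp
  finally have K2: "0 \<le> k * ((1 + r + r\<^sup>2) * q * (1 + r * y)) - (1 + r + r\<^sup>2 * y) * 1"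
    by simp
  have "(2 * k - r * y) * ((1 + r + r\<^sup>2) * q * (1 + r * y)) - (1 + r + r\<^sup>2 * y) * (2 + r * q * y)
      = r\<^sup>2 * (2 - y\<^sup>2 * (1 + r)) + (y * (3 * r ^ 3 + r ^ 4) + y\<^sup>2 * (r ^ 4 + r ^ 5))"
    using kq unfolding q_r by algebra
  also have "\<dots> > 0"
  proof -
    have "y\<^sup>2 * (1 + r) \<le> 1 * (1 + r)" using y y2 r by (intro mult_right_mono) auto
    also have "\<dots> < 2" using r by simp
    finally have "0 < 2 - y\<^sup>2 * (1 + r)" by simp
    then show ?thesis
      by (intro add_pos_nonneg add_nonneg_nonneg mult_nonneg_nonneg mult_pos_pos)
        (use r y y2 in simp_all)
  qed
  finally have K3: "0 < (2 * k - r * y) * ((1 + r + r\<^sup>2) * q * (1 + r * y))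
        - (1 + r + r\<^sup>2 * y) * (2 + r * q * y)" .
  show "K s / D s < K t / D t"
    using quadratic_ratio_less[OF d zero_le_one K1 K2 K3 st] by (simp add: K_def D_def k_def)
qed

lemma payoff_decreasing_two:
  fixes lam mu q :: real
  assumes "lam > 0" "mu > 0" "0 < q" "q < 1"
    and rewards: "beta lam mu q 2 < r1" "r1 < r2" "r2 < alpha lam mu q 3"
  shows "payoff lam mu q r1 (nash_threshold lam mu q 2 r1) 2 2
       > payoff lam mu q r2 (nash_threshold lam mu q 2 r2) 2 2"
proof -
  define r where "r = 1 - q"
  define y where "y = q / (lam / mu + q)"
  define D where "D = (\<lambda>t. t\<^sup>2 + (2 + r * q * y) * t + (1 + r + r\<^sup>2) * q * (1 + r * y))"
  define N where "N = (\<lambda>t. 2 / q * t\<^sup>2 + (4 - r + r\<^sup>2) / q * t + (2 + r + r\<^sup>2 + y * r * (1 + r)))"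
  define K where "K = (\<lambda>t. 1 / q * t\<^sup>2 + (2 / q - r * y) * t + (1 + r + r\<^sup>2 * y))"
  define T where "T = (\<lambda>p. lam * p / mu)"
  let ?w = "\<lambda>p. wait lam mu q (2 + p)"
  have r: "0 < r" "r < 1" using assms by (auto simp: r_def)
  have "0 < lam / mu + q" using assms by (simp add: add_pos_pos)
  then have y: "0 \<le> y" "y \<le> 1" using assms by (auto simp: y_def divide_le_eq_1)
  have w33: "?w p 3 3 = (1 / q + N (T p) / D (T p)) / mu"
    and w22: "?w p 2 2 - ?w p 3 3 = (r * (K (T p) / D (T p)) - 1 / q) / mu"
    if "0 \<le> p" "p \<le> 1" for p
    using wait_two[OF assms(1-4) that] by (simp_all only: N_def K_def D_def T_def r_def y_def)
  have T: "0 \<le> T p" "T p < T s" if "0 \<le> p" "p < s" for p s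
    using that assms by (auto simp: T_def divide_strict_right_mono)
  have less: "N (T p) / D (T p) < N (T s) / D (T s)" "K (T p) / D (T p) < K (T s) / D (T s)"
    if "0 \<le> p" "p < s" for p s
    using two_customer_ratios_less[OF assms(3,4) y T[OF that]]
    by (simp_all only: N_def K_def D_def r_def)
  have mono: "?w p 3 3 < ?w s 3 3" if "0 \<le> p" "p < s" "s \<le> 1" for p s
    using less(1)[OF that(1,2)] w33[of p] w33[of s] that assms
    by (simp add: divide_strict_right_mono)
  have incr: "?w s 3 3 - ?w p 3 3 < ?w s 2 2 - ?w p 2 2" if "0 \<le> p" "p < s" "s \<le> 1" for p s
  proof -
    have "r * (K (T p) / D (T p)) < r * (K (T s) / D (T s))"
      using less(2)[OF that(1,2)] r(1) by (rule mult_strict_left_mono)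
    then have "(r * (K (T p) / D (T p)) - 1 / q) / mu < (r * (K (T s) / D (T s)) - 1 / q) / mu"
      using assms by (intro divide_strict_right_mono) auto
    then have "?w p 2 2 - ?w p 3 3 < ?w s 2 2 - ?w s 3 3"
      using w22[of p] w22[of s] that by simp
    then show ?thesis by simp
  qed
  have cont: "continuous_on {0..1} (\<lambda>p. ?w p 3 3)"
  proof -
    have "D (T p) \<noteq> 0" if "p \<in> {0..1}" for p
    proof -
      have "T p \<ge> 0" using that assms by (simp add: T_def)
      then have "D (T p) > 0"
        unfolding D_def using r y assms
        by (intro add_nonneg_pos add_nonneg_nonneg mult_pos_pos mult_nonneg_nonneg add_pos_nonneg) auto
      then show ?thesis by simp
    qed
    moreover have "continuous_on {0..1} (\<lambda>p. N (T p))" "continuous_on {0..1} (\<lambda>p. D (T p))"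
      unfolding N_def D_def T_def using assms by (intro continuous_intros; simp)+
    ultimately have "continuous_on {0..1} (\<lambda>p. (1 / q + N (T p) / D (T p)) / mu)"
      using assms by (intro continuous_intros) auto
    then show ?thesis by (rule continuous_on_eq) (use w33 in auto)
  qed
  have "(2::nat) + 1 = 3" by simp
  from payoff_decreasing_from_increments[of lam mu q 2 r1 r2, unfolded this of_nat_numeral]
  show ?thesis using cont mono incr rewards by blast
qed

section \<open>Comparison of the equilibrium payoffs\<close>

theorem mainTheorem4:
  fixes lam mu q r1 r2 x1 x2 :: real and m :: nat
  assumes "lam > 0" and "mu > 0" and "0 < q" and "q < 1"
    and "m \<in> {1, 2}"
    and "beta lam mu q m < r1" and "r1 < r2" and "r2 < alpha lam mu q (m + 1)"
    and "x1 = nash_threshold lam mu q m r1"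
    and "x2 = nash_threshold lam mu q m r2"
  shows "payoff lam mu q r1 x1 m m > payoff lam mu q r2 x2 m m"
proof -
  from assms(5) consider "m = 1" | "m = 2" by blast
  then show ?thesis
  proof cases
    case 1
    with payoff_decreasing_one[OF assms(1-4), of r1 r2] assms(6-10) show ?thesis
      by (simp only: one_add_one)
  next
    case 2
    have "(2::nat) + 1 = 3" by simp
    with 2 payoff_decreasing_two[OF assms(1-4), of r1 r2] assms(6-10) show ?thesis
      by simp
  qed
qed

end
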